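(* Let $R$ be an algebra over a field $F$. If $R$ is $T$-residually Hopfian, then $R$ is Hopfian.
   Context: Algebras are associative algebras over a field $F$. An algebra $R$ is Hopfian if every epimorphism (i.e., surjective algebra homomorphism) $R \to R$ is an isomorphism. A $T$-ideal of an algebra $R$ is an ideal $I$ of $R$ that is invariant under all ring endomorphisms of $R$ (i.e., $\varphi(I)\subseteq I$ for every ring endomorphism $\varphi$ of $R$). An algebra $R$ is $T$-residually Hopfian if the intersection of those $T$-ideals $I$ of $R$ for which $R/I$ is Hopfian is $0$. *)

theory Defs
  imports "HOL-Algebra.Algebra"
begin

(* Associative algebras over a field, not assumed to be commutative or to have an identity
   element. They are carried by the library's module record, which inherits a field "one" from
   the ring record; that field is unconstrained and plays no role below. *)
locale assoc_algebra = field F + module F R for F (structure) and R (structure) +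
  assumes mult_closed:
      "\<lbrakk>x \<in> carrier R; y \<in> carrier R\<rbrakk> \<Longrightarrow> x \<otimes>\<^bsub>R\<^esub> y \<in> carrier R"
    and mult_assoc:
      "\<lbrakk>x \<in> carrier R; y \<in> carrier R; z \<in> carrier R\<rbrakk> \<Longrightarrow>
        (x \<otimes>\<^bsub>R\<^esub> y) \<otimes>\<^bsub>R\<^esub> z = x \<otimes>\<^bsub>R\<^esub> (y \<otimes>\<^bsub>R\<^esub> z)"
    and mult_l_distr:
      "\<lbrakk>x \<in> carrier R; y \<in> carrier R; z \<in> carrier R\<rbrakk> \<Longrightarrow>
        (x \<oplus>\<^bsub>R\<^esub> y) \<otimes>\<^bsub>R\<^esub> z = x \<otimes>\<^bsub>R\<^esub> z \<oplus>\<^bsub>R\<^esub> y \<otimes>\<^bsub>R\<^esub> z"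
    and mult_r_distr:
      "\<lbrakk>x \<in> carrier R; y \<in> carrier R; z \<in> carrier R\<rbrakk> \<Longrightarrow>
        z \<otimes>\<^bsub>R\<^esub> (x \<oplus>\<^bsub>R\<^esub> y) = z \<otimes>\<^bsub>R\<^esub> x \<oplus>\<^bsub>R\<^esub> z \<otimes>\<^bsub>R\<^esub> y"
    and smult_mult_left:
      "\<lbrakk>a \<in> carrier F; x \<in> carrier R; y \<in> carrier R\<rbrakk> \<Longrightarrow>
        (a \<odot>\<^bsub>R\<^esub> x) \<otimes>\<^bsub>R\<^esub> y = a \<odot>\<^bsub>R\<^esub> (x \<otimes>\<^bsub>R\<^esub> y)"
    and smult_mult_right:
      "\<lbrakk>a \<in> carrier F; x \<in> carrier R; y \<in> carrier R\<rbrakk> \<Longrightarrow>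
        x \<otimes>\<^bsub>R\<^esub> (a \<odot>\<^bsub>R\<^esub> y) = a \<odot>\<^bsub>R\<^esub> (x \<otimes>\<^bsub>R\<^esub> y)"

(* The library's ring_hom additionally preserves "one", so it cannot be used here. *)
definition rng_hom :: "('a, 'm) ring_scheme \<Rightarrow> ('b, 'n) ring_scheme \<Rightarrow> ('a \<Rightarrow> 'b) set"
  where "rng_hom R S =
    {h \<in> carrier R \<rightarrow> carrier S. \<forall>x \<in> carrier R. \<forall>y \<in> carrier R.
        h (x \<oplus>\<^bsub>R\<^esub> y) = h x \<oplus>\<^bsub>S\<^esub> h y \<and> h (x \<otimes>\<^bsub>R\<^esub> y) = h x \<otimes>\<^bsub>S\<^esub> h y}"

definition algebra_hom ::
    "('k, 'l) ring_scheme \<Rightarrow> ('k, 'a, 'm) module_scheme \<Rightarrow> ('k, 'b, 'n) module_scheme \<Rightarrow> ('a \<Rightarrow> 'b) set"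
  where "algebra_hom F R S =
    {h \<in> rng_hom R S. \<forall>a \<in> carrier F. \<forall>x \<in> carrier R. h (a \<odot>\<^bsub>R\<^esub> x) = a \<odot>\<^bsub>S\<^esub> h x}"

definition algebra_epi ::
    "('k, 'l) ring_scheme \<Rightarrow> ('k, 'a, 'm) module_scheme \<Rightarrow> ('k, 'b, 'n) module_scheme \<Rightarrow> ('a \<Rightarrow> 'b) set"
  where "algebra_epi F R S = {h \<in> algebra_hom F R S. h ` carrier R = carrier S}"

definition algebra_iso ::
    "('k, 'l) ring_scheme \<Rightarrow> ('k, 'a, 'm) module_scheme \<Rightarrow> ('k, 'b, 'n) module_scheme \<Rightarrow> ('a \<Rightarrow> 'b) set"
  where "algebra_iso F R S = {h \<in> algebra_hom F R S. bij_betw h (carrier R) (carrier S)}"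

definition hopfian :: "('k, 'l) ring_scheme \<Rightarrow> ('k, 'a, 'm) module_scheme \<Rightarrow> bool"
  where "hopfian F R \<longleftrightarrow> algebra_epi F R R \<subseteq> algebra_iso F R R"

(* Without an identity element, closure under scalars does not follow from absorption. *)
definition algebra_ideal ::
    "('k, 'l) ring_scheme \<Rightarrow> ('k, 'a, 'm) module_scheme \<Rightarrow> 'a set \<Rightarrow> bool"
  where "algebra_ideal F R I \<longleftrightarrow> submodule I F R \<and>
    (\<forall>x \<in> I. \<forall>r \<in> carrier R. r \<otimes>\<^bsub>R\<^esub> x \<in> I \<and> x \<otimes>\<^bsub>R\<^esub> r \<in> I)"

(* The library's FactRing, extended by the scalar action a (I + x) = I + a x, which is written
   as a union over representatives in the style of the library's rcoset_mult. *)
definition quotient_algebra ::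
    "('k, 'a, 'm) module_scheme \<Rightarrow> 'a set \<Rightarrow> ('k, 'a set) module"
  where "quotient_algebra R I =
    ring.extend (R Quot I) (module.fields (\<lambda>a C. \<Union>x \<in> C. I +>\<^bsub>R\<^esub> (a \<odot>\<^bsub>R\<^esub> x)))"

(* Invariance is under all ring endomorphisms, which need not be F-linear. *)
definition T_ideal :: "('k, 'l) ring_scheme \<Rightarrow> ('k, 'a, 'm) module_scheme \<Rightarrow> 'a set \<Rightarrow> bool"
  where "T_ideal F R I \<longleftrightarrow> algebra_ideal F R I \<and> (\<forall>h \<in> rng_hom R R. h ` I \<subseteq> I)"

definition T_residually_hopfian ::
    "('k, 'l) ring_scheme \<Rightarrow> ('k, 'a, 'm) module_scheme \<Rightarrow> bool"
  where "T_residually_hopfian F R \<longleftrightarrow>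
    \<Inter>{I. T_ideal F R I \<and> hopfian F (quotient_algebra R I)} = {\<zero>\<^bsub>R\<^esub>}"

end

theory Submission
  imports Defs
begin

text \<open>
  Let \<open>f\<close> be a surjective endomorphism of \<open>R\<close> and let \<open>f x = f y\<close>. If \<open>I\<close> is a T-ideal with Hopfian
  quotient, then \<open>f\<close> maps \<open>I\<close> into itself and so induces an endomorphism of \<open>R/I\<close>
  (\<open>induced_map_algebra_epi\<close>), which is again surjective and therefore injective. As it identifies
  the cosets of \<open>x\<close> and \<open>y\<close>, these coincide, that is, \<open>x - y \<in> I\<close> (\<open>hopfian_quotient_diff_mem\<close>).
  Since \<open>I\<close> was arbitrary, \<open>x - y\<close> lies in the intersection of all such ideals, which is zero.

  The locale \<open>ideal\<close> presupposes a ring with identity, which \<open>R\<close> need not have; so the coset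
  calculus modulo an algebra ideal is derived from the additive theory of \<open>abelian_subgroup\<close>.
\<close>

text \<open>An associative algebra together with a two-sided ideal closed under scalars.\<close>
locale algebra_with_ideal = assoc_algebra F R for F (structure) and R (structure) +
  fixes I
  assumes algebra_ideal: "algebra_ideal F R I"
begin

sublocale quot: abelian_subgroup I R
proof (rule abelian_subgroupI3)
  show "additive_subgroup I R"
    using algebra_ideal unfolding algebra_ideal_def submodule_def
    by (auto intro: additive_subgroup.intro)
  show "abelian_group R"
    by (rule abelian_group_axioms)
qed

lemma smult_mem: "\<lbrakk>a \<in> carrier F; i \<in> I\<rbrakk> \<Longrightarrow> a \<odot>\<^bsub>R\<^esub> i \<in> I"
  using algebra_ideal submodule.smult_closed[of I F R] by (simp add: algebra_ideal_def)

lemma mult_mem: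
  assumes "i \<in> I" "r \<in> carrier R"
  shows "r \<otimes>\<^bsub>R\<^esub> i \<in> I" "i \<otimes>\<^bsub>R\<^esub> r \<in> I"
  using assms algebra_ideal by (auto simp: algebra_ideal_def)

lemma mem_rcosetE:
  assumes "y \<in> I +>\<^bsub>R\<^esub> x"
  obtains i where "i \<in> I" "y = i \<oplus>\<^bsub>R\<^esub> x"
  using assms by (auto simp: a_r_coset_def')

lemma mem_rcosetI: "i \<in> I \<Longrightarrow> i \<oplus>\<^bsub>R\<^esub> x \<in> I +>\<^bsub>R\<^esub> x"
  by (auto simp: a_r_coset_def')

lemma rcoset_mult_mem:
  assumes x: "x \<in> carrier R" and y: "y \<in> carrier R"
    and "x' \<in> I +>\<^bsub>R\<^esub> x" and "y' \<in> I +>\<^bsub>R\<^esub> y"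
  shows "x' \<otimes>\<^bsub>R\<^esub> y' \<in> I +>\<^bsub>R\<^esub> (x \<otimes>\<^bsub>R\<^esub> y)"
proof -
  obtain i where i: "i \<in> I" "x' = i \<oplus>\<^bsub>R\<^esub> x"
    using assms(3) by (rule mem_rcosetE)
  obtain j where j: "j \<in> I" "y' = j \<oplus>\<^bsub>R\<^esub> y"
    using assms(4) by (rule mem_rcosetE)
  have ij: "i \<in> carrier R" "j \<in> carrier R"
    using i(1) j(1) by auto
  have "x' \<otimes>\<^bsub>R\<^esub> y' = (i \<otimes>\<^bsub>R\<^esub> y' \<oplus>\<^bsub>R\<^esub> x \<otimes>\<^bsub>R\<^esub> j) \<oplus>\<^bsub>R\<^esub> x \<otimes>\<^bsub>R\<^esub> y"
    using x y ij i(2) j(2) by (simp add: mult_closed mult_l_distr mult_r_distr M.a_assoc M.a_lcomm)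
  moreover have "i \<otimes>\<^bsub>R\<^esub> y' \<oplus>\<^bsub>R\<^esub> x \<otimes>\<^bsub>R\<^esub> j \<in> I"
    using x y i(1) j ij by (simp add: mult_mem)
  ultimately show ?thesis
    by (simp add: mem_rcosetI)
qed

lemma rcoset_smult_mem:
  assumes "a \<in> carrier F" "x \<in> carrier R" "x' \<in> I +>\<^bsub>R\<^esub> x"
  shows "a \<odot>\<^bsub>R\<^esub> x' \<in> I +>\<^bsub>R\<^esub> (a \<odot>\<^bsub>R\<^esub> x)"
  using assms(3)
proof (rule mem_rcosetE)
  fix i assume "i \<in> I" "x' = i \<oplus>\<^bsub>R\<^esub> x"
  with assms(1,2) show ?thesis
    by (simp add: smult_r_distr mem_rcosetI smult_mem)
qed

text \<open>A map defined on cosets as a union over representatives has the expected value as soon as it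
  respects the coset in question; both the scalar action on \<open>R/I\<close> and induced maps have this form.\<close>
lemma Union_rcoset_eq:
  assumes "x \<in> carrier R" "g x \<in> carrier R"
    and "\<And>x'. x' \<in> I +>\<^bsub>R\<^esub> x \<Longrightarrow> g x' \<in> I +>\<^bsub>R\<^esub> g x"
  shows "(\<Union>x' \<in> I +>\<^bsub>R\<^esub> x. I +>\<^bsub>R\<^esub> g x') = I +>\<^bsub>R\<^esub> g x"
proof (rule UN_constant_eq)
  show "x \<in> I +>\<^bsub>R\<^esub> x"
    using assms(1) by (rule quot.a_rcos_self)
  show "\<forall>x' \<in> I +>\<^bsub>R\<^esub> x. I +>\<^bsub>R\<^esub> g x' = I +>\<^bsub>R\<^esub> g x"
  proof
    fix x' assume "x' \<in> I +>\<^bsub>R\<^esub> x"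
    then show "I +>\<^bsub>R\<^esub> g x' = I +>\<^bsub>R\<^esub> g x"
      using quot.a_repr_independence'[OF assms(3) assms(2)] by simp
  qed
qed

lemma carrier_quotient_algebra:
  "carrier (quotient_algebra R I) = (\<lambda>x. I +>\<^bsub>R\<^esub> x) ` carrier R"
  by (auto simp: quotient_algebra_def FactRing_def ring.defs module.defs A_RCOSETS_def'
      a_r_coset_def')

lemma add_quotient_algebra:
  assumes "x \<in> carrier R" "y \<in> carrier R"
  shows "(I +>\<^bsub>R\<^esub> x) \<oplus>\<^bsub>quotient_algebra R I\<^esub> (I +>\<^bsub>R\<^esub> y) = I +>\<^bsub>R\<^esub> (x \<oplus>\<^bsub>R\<^esub> y)"
  using quot.a_rcos_sum[OF assms]
  by (simp add: quotient_algebra_def FactRing_def ring.defs module.defs)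

lemma mult_quotient_algebra:
  assumes x: "x \<in> carrier R" and y: "y \<in> carrier R"
  shows "(I +>\<^bsub>R\<^esub> x) \<otimes>\<^bsub>quotient_algebra R I\<^esub> (I +>\<^bsub>R\<^esub> y) = I +>\<^bsub>R\<^esub> (x \<otimes>\<^bsub>R\<^esub> y)"
proof -
  have "I +>\<^bsub>R\<^esub> (x' \<otimes>\<^bsub>R\<^esub> y') = I +>\<^bsub>R\<^esub> (x \<otimes>\<^bsub>R\<^esub> y)" if "x' \<in> I +>\<^bsub>R\<^esub> x" "y' \<in> I +>\<^bsub>R\<^esub> y" for x' y'
    using quot.a_repr_independence'[OF rcoset_mult_mem[OF x y that] mult_closed[OF x y]] by simp
  then have "rcoset_mult R I (I +>\<^bsub>R\<^esub> x) (I +>\<^bsub>R\<^esub> y) = I +>\<^bsub>R\<^esub> (x \<otimes>\<^bsub>R\<^esub> y)"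
    unfolding rcoset_mult_def
    by (intro ballI UN_constant_eq[OF quot.a_rcos_self[OF x]] UN_constant_eq[OF quot.a_rcos_self[OF y]])
  then show ?thesis
    by (simp add: quotient_algebra_def FactRing_def ring.defs module.defs)
qed

lemma smult_quotient_algebra:
  assumes "a \<in> carrier F" "x \<in> carrier R"
  shows "a \<odot>\<^bsub>quotient_algebra R I\<^esub> (I +>\<^bsub>R\<^esub> x) = I +>\<^bsub>R\<^esub> (a \<odot>\<^bsub>R\<^esub> x)"
  using Union_rcoset_eq[where g = "\<lambda>x. a \<odot>\<^bsub>R\<^esub> x", OF assms(2)] assms
  by (simp add: quotient_algebra_def ring.defs module.defs rcoset_smult_mem)

text \<open>The map \<open>I + x \<mapsto> I + h x\<close>, written as a union over all representatives \<open>x\<close> of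
  a coset. It is meaningful for additive maps \<open>h\<close> with \<open>h ` I \<subseteq> I\<close>, for which all members of the
  union agree.\<close>
definition "induced_map h C = (\<Union>x \<in> C. I +>\<^bsub>R\<^esub> h x)"

lemma induced_map_rcoset:
  assumes h: "h \<in> rng_hom R R" and inv: "h ` I \<subseteq> I" and x: "x \<in> carrier R"
  shows "induced_map h (I +>\<^bsub>R\<^esub> x) = I +>\<^bsub>R\<^esub> h x"
  unfolding induced_map_def
proof (rule Union_rcoset_eq)
  show "x \<in> carrier R" "h x \<in> carrier R"
    using h x by (auto simp: rng_hom_def)
  fix x' assume "x' \<in> I +>\<^bsub>R\<^esub> x"
  then obtain i where i: "i \<in> I" "x' = i \<oplus>\<^bsub>R\<^esub> x"
    by (rule mem_rcosetE)
  then have "h x' = h i \<oplus>\<^bsub>R\<^esub> h x"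
    using h x by (auto simp: rng_hom_def)
  then show "h x' \<in> I +>\<^bsub>R\<^esub> h x"
    using inv i(1) by (auto intro: mem_rcosetI)
qed

lemma induced_map_algebra_epi:
  assumes h: "h \<in> algebra_epi F R R" and inv: "h ` I \<subseteq> I"
  shows "induced_map h \<in> algebra_epi F (quotient_algebra R I) (quotient_algebra R I)"
proof -
  have rng: "h \<in> rng_hom R R"
    and smult: "\<And>a x. \<lbrakk>a \<in> carrier F; x \<in> carrier R\<rbrakk> \<Longrightarrow> h (a \<odot>\<^bsub>R\<^esub> x) = a \<odot>\<^bsub>R\<^esub> h x"
    and surj: "h ` carrier R = carrier R"
    using h by (auto simp: algebra_epi_def algebra_hom_def)
  have closed: "h x \<in> carrier R" if "x \<in> carrier R" for x
    using rng that by (auto simp: rng_hom_def)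
  have add: "h (x \<oplus>\<^bsub>R\<^esub> y) = h x \<oplus>\<^bsub>R\<^esub> h y" and mult: "h (x \<otimes>\<^bsub>R\<^esub> y) = h x \<otimes>\<^bsub>R\<^esub> h y"
    if "x \<in> carrier R" "y \<in> carrier R" for x y
    using rng that by (auto simp: rng_hom_def)
  note induced = induced_map_rcoset[OF rng inv]
  have "induced_map h \<in> algebra_hom F (quotient_algebra R I) (quotient_algebra R I)"
    unfolding algebra_hom_def rng_hom_def carrier_quotient_algebra
    by (auto simp: induced closed add mult smult mult_closed add_quotient_algebra
        mult_quotient_algebra smult_quotient_algebra)
  moreover have "induced_map h ` carrier (quotient_algebra R I) = carrier (quotient_algebra R I)"
  proof -
    have "induced_map h ` carrier (quotient_algebra R I)
        = (\<lambda>x. I +>\<^bsub>R\<^esub> x) ` (h ` carrier R)"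
      unfolding carrier_quotient_algebra image_image by (rule image_cong) (simp_all add: induced)
    then show ?thesis
      by (simp add: surj carrier_quotient_algebra)
  qed
  ultimately show ?thesis
    by (simp add: algebra_epi_def)
qed

lemma hopfian_quotient_diff_mem:
  assumes hopf: "hopfian F (quotient_algebra R I)"
    and h: "h \<in> algebra_epi F R R" and inv: "h ` I \<subseteq> I"
    and x: "x \<in> carrier R" and y: "y \<in> carrier R" and eq: "h x = h y"
  shows "x \<ominus>\<^bsub>R\<^esub> y \<in> I"
proof -
  have rng: "h \<in> rng_hom R R"
    using h by (simp add: algebra_epi_def algebra_hom_def)
  have "inj_on (induced_map h) (carrier (quotient_algebra R I))"
    using hopf induced_map_algebra_epi[OF h inv]
    by (auto simp: hopfian_def algebra_iso_def bij_betw_def)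
  moreover have "induced_map h (I +>\<^bsub>R\<^esub> x) = induced_map h (I +>\<^bsub>R\<^esub> y)"
    using eq by (simp add: induced_map_rcoset[OF rng inv] x y)
  ultimately have "I +>\<^bsub>R\<^esub> x = I +>\<^bsub>R\<^esub> y"
    using x y by (auto simp: carrier_quotient_algebra dest: inj_onD)
  then have "x \<in> I +>\<^bsub>R\<^esub> y"
    using quot.a_rcos_self[OF x] by simp
  then show ?thesis
    using quot.a_rcos_module[OF y x] by (simp add: a_minus_def)
qed

end

theorem proposition2p6:
  fixes F :: "('k, 'l) ring_scheme" and R :: "('k, 'a, 'm) module_scheme"
  assumes "assoc_algebra F R"
    and "T_residually_hopfian F R"
  shows "hopfian F R"
proof -
  interpret assoc_algebra F R
    by (rule assms(1))
  have "f \<in> algebra_iso F R R" if f: "f \<in> algebra_epi F R R" for f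
  proof -
    have hom: "f \<in> algebra_hom F R R" and surj: "f ` carrier R = carrier R"
      using f by (auto simp: algebra_epi_def)
    have "inj_on f (carrier R)"
    proof (rule inj_onI)
      fix x y assume x: "x \<in> carrier R" and y: "y \<in> carrier R" and eq: "f x = f y"
      have "x \<ominus>\<^bsub>R\<^esub> y \<in> I" if "T_ideal F R I" and hopf: "hopfian F (quotient_algebra R I)" for I
      proof -
        have "algebra_ideal F R I" and inv: "f ` I \<subseteq> I"
          using that(1) hom by (auto simp: T_ideal_def algebra_hom_def)
        then interpret algebra_with_ideal F R I
          by unfold_locales
        show ?thesis
          by (rule hopfian_quotient_diff_mem[OF hopf f inv x y eq])
      qed
      then have "x \<ominus>\<^bsub>R\<^esub> y \<in> {\<zero>\<^bsub>R\<^esub>}"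
        unfolding assms(2)[unfolded T_residually_hopfian_def, symmetric] by blast
      then have "x \<oplus>\<^bsub>R\<^esub> (\<ominus>\<^bsub>R\<^esub> y) = y \<oplus>\<^bsub>R\<^esub> (\<ominus>\<^bsub>R\<^esub> y)"
        using y by (simp add: a_minus_def M.r_neg)
      then show "x = y"
        using x y by simp
    qed
    then show ?thesis
      using hom surj by (simp add: algebra_iso_def bij_betw_def)
  qed
  then show ?thesis
    by (auto simp: hopfian_def)
qed

end
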